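(* Let $B=\{w\in\mathbb{C}:|w|<1\}$ and let $X:B\to\mathbb{L}^3$ be an embedded maximal surface, given as a conformal immersion (i.e. $w=u+iv$ is a conformal (isothermal) parameter for $X$). If $X$ can be written as a graph over a convex domain in a spacelike plane of $\mathbb{L}^3$, then the conjugate surface $X^*:B\to\mathbb{L}^3$ is a graph.
   Context: $\mathbb{L}^3$ is the Lorentz-Minkowski space: $\mathbb{R}^3$ with coordinates $(x_1,x_2,x_3)$ and the metric $\langle\cdot,\cdot\rangle=dx_1^2+dx_2^2-dx_3^2$. A plane is spacelike if the restriction of $\langle\cdot,\cdot\rangle$ to it is positive definite. An immersion of a surface in $\mathbb{L}^3$ is spacelike if the induced metric is Riemannian. A maximal surface is a spacelike surface whose mean curvature vanishes at every point. A conformal immersion $X:B\to\mathbb{L}^3$ is one satisfying $\langle X_u,X_u\rangle=\langle X_v,X_v\rangle>0$ and $\langle X_u,X_v\rangle=0$. Conjugate surface: for a conformal maximal surface $X:B\to\mathbb{L}^3$ with $w=u+iv$, the conjugate surface $X^*:B\to\mathbb{L}^3$ is the map, unique up to an additive constant vector, that solves $$X^*_u=-X_v,\qquad X^*_v=X_u .$$ It is again a conformal spacelike immersion and a maximal surface. Graph: a surface $Y:B\to\mathbb{L}^3$ is a graph over a domain $D$ of a plane $Q$ if $\pi_Q\circ Y:B\to Q$ is injective with image $D$, where $\pi_Q$ is the orthogonal projection onto $Q$; it is a graph (with no plane named) if it is a graph over some domain of some plane. *)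

theory Defs
  imports "HOL-Analysis.Analysis"
begin

definition lorentz :: "real^3 \<Rightarrow> real^3 \<Rightarrow> real" where
  "lorentz x y = x$1 * y$1 + x$2 * y$2 - x$3 * y$3"

subsection \<open>Planes, orthogonal projections and graphs\<close>

text \<open>Planes are affine, not necessarily through the origin.\<close>

definition plane :: "(real^3) set \<Rightarrow> bool" where
  "plane Q \<longleftrightarrow> affine Q \<and> aff_dim Q = 2"

definition spacelike_plane :: "(real^3) set \<Rightarrow> bool" where
  "spacelike_plane Q \<longleftrightarrow>
     plane Q \<and> (\<forall>p\<in>Q. \<forall>q\<in>Q. p \<noteq> q \<longrightarrow> lorentz (p - q) (p - q) > 0)"

text \<open>The projection along the Lorentz-orthogonal complement is well defined exactly when the
  metric restricted to the plane is nondegenerate, i.e. when the plane is not lightlike.\<close>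

definition nondegenerate_plane :: "(real^3) set \<Rightarrow> bool" where
  "nondegenerate_plane Q \<longleftrightarrow>
     plane Q \<and>
     (\<forall>p\<in>Q. \<forall>q\<in>Q. (\<forall>r\<in>Q. \<forall>s\<in>Q. lorentz (p - q) (r - s) = 0) \<longrightarrow> p = q)"

definition lorentz_proj :: "(real^3) set \<Rightarrow> real^3 \<Rightarrow> real^3" where
  "lorentz_proj Q x = (THE p. p \<in> Q \<and> (\<forall>r\<in>Q. \<forall>s\<in>Q. lorentz (x - p) (r - s) = 0))"

definition plane_domain :: "(real^3) set \<Rightarrow> (real^3) set \<Rightarrow> bool" where
  "plane_domain Q D \<longleftrightarrow> D \<noteq> {} \<and> connected D \<and> openin (top_of_set Q) D"

definition graph_over ::
    "complex set \<Rightarrow> (complex \<Rightarrow> real^3) \<Rightarrow> (real^3) set \<Rightarrow> (real^3) set \<Rightarrow> bool" where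
  "graph_over B Y Q D \<longleftrightarrow>
     nondegenerate_plane Q \<and> plane_domain Q D \<and>
     inj_on (lorentz_proj Q \<circ> Y) B \<and> (lorentz_proj Q \<circ> Y) ` B = D"

definition is_graph :: "complex set \<Rightarrow> (complex \<Rightarrow> real^3) \<Rightarrow> bool" where
  "is_graph B Y \<longleftrightarrow> (\<exists>Q D. graph_over B Y Q D)"

subsection \<open>Parametrized surfaces\<close>

text \<open>Partial derivatives with respect to the real coordinates of \<open>w = u + i v\<close>. They are only
  meaningful at points of differentiability.\<close>

definition du :: "(complex \<Rightarrow> real^3) \<Rightarrow> complex \<Rightarrow> real^3" where
  "du X w = frechet_derivative X (at w) 1"

definition dv :: "(complex \<Rightarrow> real^3) \<Rightarrow> complex \<Rightarrow> real^3" where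
  "dv X w = frechet_derivative X (at w) \<i>"

text \<open>On open sets this is \<open>k\<close>-fold real continuous differentiability.\<close>

primrec Ck_on :: "nat \<Rightarrow> complex set \<Rightarrow> (complex \<Rightarrow> real^3) \<Rightarrow> bool" where
  "Ck_on 0 B X \<longleftrightarrow> continuous_on B X"
| "Ck_on (Suc k) B X \<longleftrightarrow>
     (\<forall>w\<in>B. X differentiable (at w)) \<and> Ck_on k B (du X) \<and> Ck_on k B (dv X)"

definition smooth_map_on :: "complex set \<Rightarrow> (complex \<Rightarrow> real^3) \<Rightarrow> bool" where
  "smooth_map_on B X \<longleftrightarrow> (\<forall>k. Ck_on k B X)"

text \<open>Positive definiteness of the induced metric already forces the differential to be injective,
  so a separate immersion condition is not needed.\<close>

definition spacelike_immersion :: "complex set \<Rightarrow> (complex \<Rightarrow> real^3) \<Rightarrow> bool" where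
  "spacelike_immersion B X \<longleftrightarrow>
     smooth_map_on B X \<and>
     (\<forall>w\<in>B. \<forall>h. h \<noteq> 0 \<longrightarrow>
        lorentz (frechet_derivative X (at w) h) (frechet_derivative X (at w) h) > 0)"

definition conformal_immersion :: "complex set \<Rightarrow> (complex \<Rightarrow> real^3) \<Rightarrow> bool" where
  "conformal_immersion B X \<longleftrightarrow>
     smooth_map_on B X \<and>
     (\<forall>w\<in>B. lorentz (du X w) (du X w) = lorentz (dv X w) (dv X w) \<and>
             lorentz (du X w) (du X w) > 0 \<and>
             lorentz (du X w) (dv X w) = 0)"

subsection \<open>Mean curvature\<close>

text \<open>Flipping the third coordinate of the Euclidean cross product gives a vector that is
  Lorentz-orthogonal to both factors.\<close>

definition lorentz_cross :: "real^3 \<Rightarrow> real^3 \<Rightarrow> real^3" where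
  "lorentz_cross a b = vector [cross3 a b $ 1, cross3 a b $ 2, - (cross3 a b $ 3)]"

text \<open>The normal of a spacelike surface is timelike, whence the sign under the root.\<close>

definition unit_normal :: "(complex \<Rightarrow> real^3) \<Rightarrow> complex \<Rightarrow> real^3" where
  "unit_normal X w =
     (let n = lorentz_cross (du X w) (dv X w) in n /\<^sub>R sqrt (- lorentz n n))"

text \<open>Half the trace of the second fundamental form \<open>(e, f, g)\<close> with respect to the first
  fundamental form \<open>(E, F, G)\<close>. Some authors insert a further sign because the normal is timelike;
  this does not affect the vanishing of the mean curvature.\<close>

definition mean_curvature :: "(complex \<Rightarrow> real^3) \<Rightarrow> complex \<Rightarrow> real" where
  "mean_curvature X w =
     (let E = lorentz (du X w) (du X w);
          F = lorentz (du X w) (dv X w);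
          G = lorentz (dv X w) (dv X w);
          e = lorentz (du (du X) w) (unit_normal X w);
          f = lorentz (dv (du X) w) (unit_normal X w);
          g = lorentz (dv (dv X) w) (unit_normal X w)
      in (e * G - 2 * f * F + g * E) / (2 * (E * G - F\<^sup>2)))"

definition maximal_surface :: "complex set \<Rightarrow> (complex \<Rightarrow> real^3) \<Rightarrow> bool" where
  "maximal_surface B X \<longleftrightarrow> spacelike_immersion B X \<and> (\<forall>w\<in>B. mean_curvature X w = 0)"

definition embedded_surface :: "complex set \<Rightarrow> (complex \<Rightarrow> real^3) \<Rightarrow> bool" where
  "embedded_surface B X \<longleftrightarrow> embedding_map (top_of_set B) euclidean X"

text \<open>The conjugate surface is determined only up to a translation, hence a relation.\<close>

definition conjugate_surface ::
    "complex set \<Rightarrow> (complex \<Rightarrow> real^3) \<Rightarrow> (complex \<Rightarrow> real^3) \<Rightarrow> bool" where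
  "conjugate_surface B X Y \<longleftrightarrow>
     (\<forall>w\<in>B. Y differentiable (at w) \<and> du Y w = - dv X w \<and> dv Y w = du X w)"

end

theory Submission
  imports Defs
begin

text \<open>Krust's argument. Projecting orthogonally to the spacelike plane turns the surface into a
  planar map \<open>f\<close> and its conjugate into a planar map \<open>g\<close> with \<open>dg(h) = df(-ih)\<close>. The preimage under
  \<open>f\<close> of a segment with direction \<open>z\<close> in the convex domain is a curve \<open>c\<close> with \<open>df(c') = z\<close>, and
  \<open>dg(c') = df(-ic')\<close> is never a real multiple of \<open>z\<close> because \<open>df\<close> is injective. By Rolle's theorem
  \<open>Im (g \<circ> c / z)\<close> takes different values at the ends of the curve, so \<open>g\<close> is injective. The
  differential \<open>df\<close> is injective because no spacelike vector is orthogonal to a spacelike plane.\<close>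

section \<open>Planar maps: injectivity of the conjugate map\<close>

lemma inj_on_conjugate_of_convex_image:
  fixes f g :: "complex \<Rightarrow> complex"
  assumes "open B" and inj: "inj_on f B" and conv: "convex (f ` B)"
    and f: "\<And>w. w \<in> B \<Longrightarrow> (f has_derivative F w) (at w)"
    and injF: "\<And>w. w \<in> B \<Longrightarrow> inj (F w)"
    and g: "\<And>w. w \<in> B \<Longrightarrow> (g has_derivative (\<lambda>h. F w (- \<i> * h))) (at w)"
  shows "inj_on g B"
proof (rule inj_onI, rule ccontr)
  fix p q assume pq: "p \<in> B" "q \<in> B" "g p = g q" "p \<noteq> q"
  define z where "z = f q - f p"
  have z0: "z \<noteq> 0" using inj pq by (auto simp: z_def inj_on_def)
  define c where "c t = inv_into B f (f p + of_real t * z)" for t :: real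
  have inB: "f p + of_real t * z \<in> f ` B" if "t \<in> {0..1}" for t
  proof -
    have "f p + of_real t * z = (1 - t) *\<^sub>R f p + t *\<^sub>R f q"
      by (simp add: z_def scaleR_conv_of_real algebra_simps)
    also have "\<dots> \<in> f ` B"
      using conv pq(1,2) that by (intro convexD_alt) auto
    finally show ?thesis .
  qed
  have c: "c t \<in> B" "f (c t) = f p + of_real t * z" if "t \<in> {0..1}" for t
    unfolding c_def using inB[OF that] by (simp_all add: inv_into_into f_inv_into_f)
  have contf: "continuous_on B f"
    using f by (meson continuous_at_imp_continuous_on has_derivative_continuous)
  \<comment> \<open>The witness \<open>h\<close> is the velocity of \<open>c\<close> at
    \<open>t\<close>. Dividing by \<open>z\<close> makes the real multiples of \<open>z\<close>
    exactly the vectors of imaginary part zero.\<close>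
  have "\<exists>h. F (c t) h = z \<and>
      ((\<lambda>t. Im (g (c t) / z)) has_derivative (\<lambda>s. s * Im (F (c t) (- \<i> * h) / z))) (at t)"
    if t: "t \<in> {0..1}" for t
  proof -
    let ?w = "c t"
    have lin: "linear (F ?w)" using f[OF c(1)[OF t]] has_derivative_linear by blast
    obtain G where G: "linear G" "G \<circ> F ?w = id"
      using linear_injective_left_inverse[OF lin injF[OF c(1)[OF t]]] by blast
    have FG: "F ?w \<circ> G = id"
      using linear_inverse_left[OF lin G(1)] G(2) by blast
    \<comment> \<open>The inverse is differentiable in a full neighbourhood sense, since
      \<open>f\<close> maps neighbourhoods of \<open>?w\<close> to neighbourhoods of
      \<open>f ?w\<close>. So \<open>c\<close> has a two-sided derivative even at the ends
      \<open>0\<close> and \<open>1\<close>.\<close>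
    have dinv: "(inv_into B f has_derivative G) (at (f ?w))"
      by (rule has_derivative_inverse_strong[OF \<open>open B\<close> c(1)[OF t] contf
            inv_into_f_f[OF inj] f[OF c(1)[OF t]] FG])
    have "((\<lambda>t::real. f p + of_real t * z) has_derivative (\<lambda>s. of_real s * z)) (at t)"
      by (auto intro!: derivative_eq_intros)
    then have dc: "(c has_derivative (\<lambda>s. G (of_real s * z))) (at t)"
      unfolding c_def by (rule has_derivative_compose) (use dinv c(2)[OF t] in simp)
    have "((\<lambda>t. g (c t)) has_derivative (\<lambda>s. F ?w (- \<i> * G (of_real s * z)))) (at t)"
      using has_derivative_compose[OF dc g[OF c(1)[OF t]]] .
    then have "((\<lambda>t. Im (g (c t) / z)) has_derivative
        (\<lambda>s. Im (F ?w (- \<i> * G (of_real s * z)) / z))) (at t)"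
      unfolding divide_inverse
      by (intro bounded_linear.has_derivative[OF bounded_linear_Im] has_derivative_mult_left)
    \<comment> \<open>\<open>F ?w\<close> and \<open>G\<close> are only real linear, so the real
      factor \<open>s\<close> comes out but \<i> does not; \<open>G z\<close> is the velocity
      sought.\<close>
    moreover have "F ?w (- \<i> * G (of_real s * z)) = of_real s * F ?w (- \<i> * G z)" for s :: real
    proof -
      have "- \<i> * G (of_real s * z) = s *\<^sub>R (- \<i> * G z)"
        using linear_scale[OF G(1), of s z] by (simp add: scaleR_conv_of_real)
      then show ?thesis
        using linear_scale[OF lin, of s "- \<i> * G z"] by (simp only: scaleR_conv_of_real)
    qed
    ultimately have "((\<lambda>t. Im (g (c t) / z)) has_derivative
        (\<lambda>s. s * Im (F ?w (- \<i> * G z) / z))) (at t)"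
      by (simp flip: times_divide_eq_right)
    moreover have "F ?w (G z) = z" using FG by (metis comp_apply id_apply)
    ultimately show ?thesis by blast
  qed
  then obtain h where h: "\<And>t. t \<in> {0..1} \<Longrightarrow> F (c t) (h t) = z"
    and k: "\<And>t. t \<in> {0..1} \<Longrightarrow> ((\<lambda>t. Im (g (c t) / z)) has_derivative
        (\<lambda>s. s * Im (F (c t) (- \<i> * h t) / z))) (at t)"
    by metis
  have "c 0 = p" "c 1 = q"
    using pq(1,2) inj by (simp_all add: c_def z_def)
  then have ends: "Im (g (c 0) / z) = Im (g (c 1) / z)" using pq(3) by simp
  have cont: "continuous_on {0..1} (\<lambda>t. Im (g (c t) / z))"
    using k by (meson continuous_at_imp_continuous_on has_derivative_continuous)
  obtain t where t: "0 < t" "t < 1" "(\<lambda>s. s * Im (F (c t) (- \<i> * h t) / z)) = (\<lambda>v. 0)"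
    using Rolle_deriv[OF _ ends cont k] by force
  then have "t \<in> {0..1}" by simp
  note ht = h[OF this] and wB = c(1)[OF this]
  \<comment> \<open>At the Rolle point the quotient is a real number \<open>r\<close>, so
    \<open>F (c t)\<close> agrees on \<open>- \<i> * h t\<close> and \<open>r *\<^sub>R h t\<close>.
    Injectivity would then make \<open>- \<i>\<close> real.\<close>
  define r where "r = Re (F (c t) (- \<i> * h t) / z)"
  have "Im (F (c t) (- \<i> * h t) / z) = 0" using fun_cong[OF t(3), of 1] by simp
  then have "F (c t) (- \<i> * h t) / z = of_real r" by (simp add: r_def complex_eq_iff)
  then have "F (c t) (- \<i> * h t) = r *\<^sub>R z"
    using z0 by (simp add: field_simps scaleR_conv_of_real)
  also have "\<dots> = F (c t) (r *\<^sub>R h t)"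
    using ht linear_scale[OF has_derivative_linear[OF f[OF wB]]] by metis
  finally have "- \<i> * h t = of_real r * h t"
    using injF[OF wB] by (simp add: inj_def scaleR_conv_of_real)
  moreover have "h t \<noteq> 0"
    using ht z0 linear_0[OF has_derivative_linear[OF f[OF wB]]] by auto
  ultimately have "- \<i> = of_real r" by (metis mult_right_cancel)
  then show False by (simp add: complex_eq_iff)
qed

section \<open>Orthonormal frames and projections for spacelike planes\<close>

lemma lorentz_commute: "lorentz x y = lorentz y x"
  by (simp add: lorentz_def)

lemma lorentz_simps:
  "lorentz (x + y) z = lorentz x z + lorentz y z"
  "lorentz (x - y) z = lorentz x z - lorentz y z"
  "lorentz (a *\<^sub>R x) z = a * lorentz x z"
  "lorentz z (x + y) = lorentz z x + lorentz z y"
  "lorentz z (x - y) = lorentz z x - lorentz z y"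
  "lorentz z (a *\<^sub>R x) = a * lorentz z x"
  "lorentz 0 z = 0" "lorentz z 0 = 0"
  by (simp_all add: lorentz_def algebra_simps)

text \<open>The Gram determinant of three vectors is \<open>-det\<^sup>2\<close>, hence not positive.\<close>

lemma no_three_orthogonal_spacelike:
  assumes "lorentz a a > 0" "lorentz b b > 0" "lorentz x x > 0"
    and "lorentz a b = 0" "lorentz x a = 0" "lorentz x b = 0"
  shows False
proof -
  define d where "d = a$1 * (b$2 * x$3 - b$3 * x$2) - a$2 * (b$1 * x$3 - b$3 * x$1)
      + a$3 * (b$1 * x$2 - b$2 * x$1)"
  have "lorentz a a * lorentz b b * lorentz x x + 2 * lorentz a b * lorentz x a * lorentz x b
      - lorentz a a * (lorentz x b)\<^sup>2 - lorentz b b * (lorentz x a)\<^sup>2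
      - lorentz x x * (lorentz a b)\<^sup>2 = - d\<^sup>2"
    unfolding lorentz_def d_def by algebra
  then have "lorentz a a * lorentz b b * lorentz x x \<le> 0"
    using assms by simp
  then show False using assms by (simp add: mult_le_0_iff not_le)
qed

lemma spacelike_unit_multiple:
  assumes "subspace S" "y \<in> S" "lorentz y y > 0"
  obtains e a where "e \<in> S" "lorentz e e = 1" "y = a *\<^sub>R e"
proof
  let ?r = "sqrt (lorentz y y)"
  show "(1 / ?r) *\<^sub>R y \<in> S" using assms by (simp add: subspace_scale)
  show "lorentz ((1 / ?r) *\<^sub>R y) ((1 / ?r) *\<^sub>R y) = 1"
    using assms by (simp add: lorentz_simps field_simps)
  show "y = ?r *\<^sub>R ((1 / ?r) *\<^sub>R y)" using assms by simp
qed

text \<open>Gram-Schmidt for the Lorentz form: positivity on \<open>S\<close> lets every nonzero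
  vector that arises be normalised.\<close>

lemma spacelike_orthonormal_basis:
  assumes "subspace S" "dim S = 2"
    and pos: "\<And>x. x \<in> S \<Longrightarrow> x \<noteq> 0 \<Longrightarrow> lorentz x x > 0"
  obtains e1 e2 where "lorentz e1 e1 = 1" "lorentz e2 e2 = 1" "lorentz e1 e2 = 0"
    and "S = span {e1, e2}"
proof -
  have "\<not> S \<subseteq> {0}" using assms(2) dim_eq_0[of S] by auto
  then obtain y1 where "y1 \<in> S" "y1 \<noteq> 0" by auto
  then obtain e1 where e1: "e1 \<in> S" "lorentz e1 e1 = 1"
    using spacelike_unit_multiple[OF assms(1)] pos by metis
  have "\<not> S \<subseteq> span {e1}"
  proof
    assume "S \<subseteq> span {e1}"
    then have "dim S \<le> card {e1}" by (rule dim_le_card) simp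
    with assms(2) show False by simp
  qed
  then obtain y2 where y2: "y2 \<in> S" "y2 \<notin> span {e1}" by auto
  \<comment> \<open>Removing the \<open>e1\<close> component keeps the vector outside
    \<open>span {e1}\<close>, hence nonzero.\<close>
  define x where "x = y2 - lorentz y2 e1 *\<^sub>R e1"
  have "x \<in> S" using y2(1) e1(1) assms(1) by (simp add: x_def subspace_diff subspace_scale)
  moreover have "x \<notin> span {e1}"
  proof
    assume "x \<in> span {e1}"
    then have "x + lorentz y2 e1 *\<^sub>R e1 \<in> span {e1}"
      by (meson span_add span_base span_scale singletonI)
    with y2(2) show False by (simp add: x_def)
  qed
  ultimately have x: "x \<in> S" "x \<notin> span {e1}" by auto
  have "x \<noteq> 0" using x(2) span_0 by blast
  then obtain e2 a where e2: "e2 \<in> S" "lorentz e2 e2 = 1" "x = a *\<^sub>R e2"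
    using spacelike_unit_multiple[OF assms(1) x(1)] pos[OF x(1)] by metis
  have "lorentz x e1 = 0" using e1 by (simp add: x_def lorentz_simps)
  with e2 \<open>x \<noteq> 0\<close> have orth: "lorentz e1 e2 = 0"
    by (simp add: lorentz_simps lorentz_commute[of e1])
  have notin: "e2 \<notin> span {e1}" using x(2) e2(3) span_scale by blast
  have "independent {e2, e1}"
    using notin e1 by (auto simp: independent_insert lorentz_simps)
  moreover have "e2 \<noteq> e1" using notin span_base[of e1 "{e1}"] by blast
  then have "card {e2, e1} = 2" by simp
  moreover have "{e2, e1} \<subseteq> S" using e1(1) e2(1) by blast
  ultimately have "S \<subseteq> span {e2, e1}"
    using card_ge_dim_independent[of "{e2, e1}" S] assms(2) by linarith
  moreover have "span {e2, e1} \<subseteq> S"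
    by (rule span_minimal[OF _ assms(1)]) (use e1(1) e2(1) in blast)
  ultimately show thesis using that[OF e1(2) e2(2) orth] by (metis insert_commute subset_antisym)
qed

text \<open>Differences from a base point \<open>q\<close> form a 2-dimensional subspace on which
  the form is positive; its orthonormal basis gives coordinates on the affine plane.\<close>

lemma spacelike_plane_frame:
  assumes "spacelike_plane Q"
  obtains q e1 e2 where "lorentz e1 e1 = 1" "lorentz e2 e2 = 1" "lorentz e1 e2 = 0"
    and "Q = {q + a *\<^sub>R e1 + b *\<^sub>R e2 |a b. True}"
proof -
  have Q: "affine Q" "aff_dim Q = 2"
    and pos: "\<And>p q. p \<in> Q \<Longrightarrow> q \<in> Q \<Longrightarrow> p \<noteq> q \<Longrightarrow> lorentz (p - q) (p - q) > 0"
    using assms by (auto simp: spacelike_plane_def plane_def)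
  have "Q \<noteq> {}" using Q(2) by auto
  then obtain q where q: "q \<in> Q" by auto
  define S where "S = (\<lambda>x. x - q) ` Q"
  have S: "subspace S" using affine_diffs_subspace_subtract[OF Q(1) q] by (simp add: S_def)
  have "dim S = 2"
    using aff_dim_dim_affine_diffs[OF Q(1) q] Q(2) by (simp add: S_def)
  moreover have "lorentz x x > 0" if "x \<in> S" "x \<noteq> 0" for x
    using that pos[OF _ q] by (auto simp: S_def)
  ultimately obtain e1 e2 where e: "lorentz e1 e1 = 1" "lorentz e2 e2 = 1" "lorentz e1 e2 = 0"
    and SS: "S = span {e1, e2}"
    using spacelike_orthonormal_basis[OF S] by metis
  have span: "x \<in> span {e1, e2} \<longleftrightarrow> (\<exists>a b. x = a *\<^sub>R e1 + b *\<^sub>R e2)" for x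
    by (auto simp: span_breakdown_eq algebra_simps)
  have "x \<in> Q \<longleftrightarrow> x - q \<in> S" for x by (auto simp: S_def)
  then have "Q = {q + a *\<^sub>R e1 + b *\<^sub>R e2 |a b. True}"
    unfolding SS span by (auto simp: algebra_simps)
  then show thesis using that e by blast
qed

text \<open>Resolves the definite description: orthogonality of \<open>x - p\<close> to
  \<open>e1\<close> and \<open>e2\<close> determines both coordinates of \<open>p\<close>, and by
  bilinearity it suffices for all directions of \<open>Q\<close>.\<close>

lemma lorentz_proj_frame:
  assumes "lorentz e1 e1 = 1" "lorentz e2 e2 = 1" "lorentz e1 e2 = 0"
    and Q: "Q = {q + a *\<^sub>R e1 + b *\<^sub>R e2 |a b. True}"
  shows "lorentz_proj Q x = q + lorentz (x - q) e1 *\<^sub>R e1 + lorentz (x - q) e2 *\<^sub>R e2"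
proof -
  have e21: "lorentz e2 e1 = 0" using assms(3) by (simp add: lorentz_commute)
  show ?thesis
    unfolding lorentz_proj_def
  proof (rule the_equality)
    let ?p = "q + lorentz (x - q) e1 *\<^sub>R e1 + lorentz (x - q) e2 *\<^sub>R e2"
    have "?p \<in> Q" unfolding Q by blast
    moreover have "lorentz (x - ?p) (r - s) = 0" if "r \<in> Q" "s \<in> Q" for r s
      using that assms(1-3) e21 by (auto simp: Q lorentz_simps algebra_simps)
    ultimately show "?p \<in> Q \<and> (\<forall>r\<in>Q. \<forall>s\<in>Q. lorentz (x - ?p) (r - s) = 0)" by blast
  next
    fix p assume p: "p \<in> Q \<and> (\<forall>r\<in>Q. \<forall>s\<in>Q. lorentz (x - p) (r - s) = 0)"
    then obtain a b where ab: "p = q + a *\<^sub>R e1 + b *\<^sub>R e2" by (auto simp: Q)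
    \<comment> \<open>Differences of these points realise the test directions \<open>e1\<close> and
      \<open>e2\<close>.\<close>
    have mem: "q \<in> Q" "q + e1 \<in> Q" "q + e2 \<in> Q"
      unfolding Q by (force intro: exI[of _ 0] exI[of _ 1])+
    have "lorentz (x - p) (q + e1 - q) = 0" "lorentz (x - p) (q + e2 - q) = 0"
      using p mem by blast+
    then have "a = lorentz (x - q) e1" "b = lorentz (x - q) e2"
      using assms(1-3) e21 by (simp_all add: ab lorentz_simps)
    then show "p = q + lorentz (x - q) e1 *\<^sub>R e1 + lorentz (x - q) e2 *\<^sub>R e2"
      using ab by simp
  qed
qed

section \<open>From the surface and its conjugate to planar maps\<close>

text \<open>Both differentials are real linear, and the conjugate equations make the two sides agree
  on the real basis \<open>1\<close>, \<open>\<i>\<close>.\<close>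

lemma frechet_derivative_conjugate_surface:
  assumes "conjugate_surface B X Y" "w \<in> B" "X differentiable (at w)"
  shows "(Y has_derivative (\<lambda>h. frechet_derivative X (at w) (- \<i> * h))) (at w)"
proof -
  let ?F = "frechet_derivative X (at w)" and ?G = "frechet_derivative Y (at w)"
  have Y: "Y differentiable (at w)" "?G 1 = - ?F \<i>" "?G \<i> = ?F 1"
    using assms(1,2) by (auto simp: conjugate_surface_def du_def dv_def)
  have lin: "linear ?F" "linear ?G"
    using assms(3) Y(1) by (auto simp: linear_frechet_derivative)
  have "?G h = ?F (- \<i> * h)" for h
  proof -
    have "?G h = ?G (Re h *\<^sub>R 1 + Im h *\<^sub>R \<i>)"
      by (rule arg_cong[where f = ?G]) (simp add: complex_eq_iff)
    also have "\<dots> = Re h *\<^sub>R - ?F \<i> + Im h *\<^sub>R ?F 1"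
      by (simp only: linear_add[OF lin(2)] linear_scale[OF lin(2)] Y(2,3))
    also have "\<dots> = ?F (Re h *\<^sub>R - \<i> + Im h *\<^sub>R 1)"
      by (simp only: linear_add[OF lin(1)] linear_scale[OF lin(1)] linear_neg[OF lin(1)])
    also have "Re h *\<^sub>R - \<i> + Im h *\<^sub>R 1 = - \<i> * h" by (simp add: complex_eq_iff)
    finally show ?thesis .
  qed
  then have "?G = (\<lambda>h. ?F (- \<i> * h))" by blast
  with frechet_derivative_works[THEN iffD1, OF Y(1)] show ?thesis by simp
qed

theorem theorem1p2:
  fixes B :: "complex set"
    and X X' :: "complex \<Rightarrow> real^3"
    and Q D :: "(real^3) set"
  assumes "B = {w. cmod w < 1}"
    and "maximal_surface B X"
    and "embedded_surface B X"
    and "conformal_immersion B X"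
    and "spacelike_plane Q" and "convex D" and "graph_over B X Q D"
    and "conjugate_surface B X X'"
  shows "is_graph B X'"
proof -
  have "B = ball 0 1" using assms(1) by (auto simp: dist_norm)
  then have B: "open B" "connected B" "B \<noteq> {}" by auto
  have "spacelike_immersion B X" using assms(2) by (simp add: maximal_surface_def)
  then have "Ck_on (Suc 0) B X" and
    sp: "\<And>w h. w \<in> B \<Longrightarrow> h \<noteq> 0 \<Longrightarrow>
      lorentz (frechet_derivative X (at w) h) (frechet_derivative X (at w) h) > 0"
    by (auto simp: spacelike_immersion_def smooth_map_on_def simp del: Ck_on.simps)
  then have diffX: "X differentiable (at w)" if "w \<in> B" for w using that by simp
  obtain q e1 e2 where e: "lorentz e1 e1 = 1" "lorentz e2 e2 = 1" "lorentz e1 e2 = 0"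
    and Q: "Q = {q + a *\<^sub>R e1 + b *\<^sub>R e2 |a b. True}"
    by (rule spacelike_plane_frame[OF assms(5)])
  have e21: "lorentz e2 e1 = 0" using e(3) by (simp add: lorentz_commute)
  note proj = lorentz_proj_frame[OF e Q]
  have graph: "nondegenerate_plane Q" "inj_on (lorentz_proj Q \<circ> X) B"
    "(lorentz_proj Q \<circ> X) ` B = D"
    using assms(7) by (auto simp: graph_over_def)
  \<comment> \<open>\<open>L\<close> reads off frame coordinates as a complex number. It has the
    same fibres as the projection but is linear, so it carries \<open>D\<close> to a convex set and
    commutes with differentiation.\<close>
  define L where "L x = Complex (lorentz x e1) (lorentz x e2)" for x
  have linL: "linear L"
    by (rule linearI) (auto simp: L_def lorentz_simps complex_eq_iff)
  have bL: "bounded_linear L" using linL by (rule linear_conv_bounded_linear[THEN iffD1])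
  have L_proj: "L (lorentz_proj Q x) = L x" for x
    using e e21 by (simp add: proj L_def lorentz_simps)
  have proj_eq_iff: "lorentz_proj Q x = lorentz_proj Q y \<longleftrightarrow> L x = L y" for x y
  proof
    show "L x = L y" if "lorentz_proj Q x = lorentz_proj Q y" using that L_proj by metis
  qed (auto simp: proj L_def lorentz_simps)
  let ?F = "\<lambda>w. frechet_derivative X (at w)"
  have "inj_on (L \<circ> X') B"
  proof (rule inj_on_conjugate_of_convex_image[where f = "L \<circ> X" and F = "\<lambda>w h. L (?F w h)"])
    show "inj_on (L \<circ> X) B" using graph(2) by (auto simp: inj_on_def proj_eq_iff)
    have "(L \<circ> X) ` B = L ` D" using graph(3) L_proj by (force simp: image_iff)
    then show "convex ((L \<circ> X) ` B)" using linL assms(6) by (simp add: convex_linear_image)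
  next
    fix w assume w: "w \<in> B"
    show "(L \<circ> X has_derivative (\<lambda>h. L (?F w h))) (at w)"
      unfolding o_def
      using bounded_linear.has_derivative[OF bL]
        frechet_derivative_works[THEN iffD1, OF diffX[OF w]] by blast
    show "(L \<circ> X' has_derivative (\<lambda>h. L (?F w (- \<i> * h)))) (at w)"
      unfolding o_def
      using bounded_linear.has_derivative[OF bL]
        frechet_derivative_conjugate_surface[OF assms(8) w diffX[OF w]] by blast
    have lin: "linear (\<lambda>h. L (?F w h))"
      using linear_compose[OF linear_frechet_derivative[OF diffX[OF w]] linL] by (simp add: o_def)
    \<comment> \<open>A nonzero kernel vector would give a spacelike tangent vector orthogonal to
      \<open>e1\<close> and \<open>e2\<close>, a third spacelike direction in signature
      (2,1).\<close>
    show "inj (\<lambda>h. L (?F w h))"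
      unfolding linear_injective_0[OF lin]
    proof (intro allI impI, rule ccontr)
      fix h assume "L (?F w h) = 0" "h \<noteq> 0"
      then show False
        using no_three_orthogonal_spacelike[OF _ _ sp[OF w], of e1 e2 h] e
        by (simp add: L_def complex_eq_iff)
    qed
  qed (rule B)
  then have inj': "inj_on (lorentz_proj Q \<circ> X') B" by (auto simp: inj_on_def proj_eq_iff)
  have contX': "continuous_on B X'"
    using assms(8) by (meson conjugate_surface_def continuous_at_imp_continuous_on
        differentiable_imp_continuous_within)
  have "continuous_on UNIV (lorentz_proj Q)"
    unfolding proj[abs_def] lorentz_def by (intro continuous_intros)
  then have cont': "continuous_on B (lorentz_proj Q \<circ> X')"
    using contX' by (meson continuous_on_compose continuous_on_subset subset_UNIV)
  have affQ: "affine Q" "aff_dim Q = 2"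
    using assms(5) by (auto simp: spacelike_plane_def plane_def)
  \<comment> \<open>The conjugate is a graph over the same plane \<open>Q\<close>. Its domain is
    open by invariance of domain, as the disc and \<open>Q\<close> both have dimension 2.\<close>
  have "openin (top_of_set Q) ((lorentz_proj Q \<circ> X') ` B)"
  proof (rule invariance_of_domain_affine_sets[OF _ affine_UNIV affQ(1) _ cont' _ inj'])
    show "openin (top_of_set UNIV) B" using B(1) by simp
    show "aff_dim Q \<le> aff_dim (UNIV :: complex set)" using affQ(2) by simp
    have "lorentz_proj Q x \<in> Q" for x
      unfolding proj by (subst Q) blast
    then show "(lorentz_proj Q \<circ> X') \<in> B \<rightarrow> Q" by simp
  qed
  then have "plane_domain Q ((lorentz_proj Q \<circ> X') ` B)"
    using B connected_continuous_image[OF cont'] by (simp add: plane_domain_def)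
  with graph(1) inj' show ?thesis unfolding is_graph_def graph_over_def by blast
qed

end
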